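(* For all $n\ge1$ and $d\ge-1$, the number of $d$-dimensional faces of $CRY_n$ is the coefficient $f_d^{(n)}=[t^nx^d]F(t,x)$, where $$F(t,x):=\frac1{x-xt}+\sum_{n=0}^\infty t^nx^{-n}\prod_{i=1}^n\frac{(1+x)^i-1}{1+\big((1+x)^i-1-x\big)\,t\,x^{-1}}.$$
   Context: $K_{n+1}$ is the directed graph on $v_1,\dots,v_{n+1}$ with one edge $(v_i,v_j)$ for each $1\le i<j\le n+1$. $CRY_n=\mathrm{Flow}_n(1,0,\dots,0)\subset\mathbb R^{E(K_{n+1})}$ is the polytope of all functions $f:E(K_{n+1})\to\mathbb R_{\ge0}$ such that $\sum_{j>i}f(v_i,v_j)-\sum_{k<i}f(v_k,v_i)$ equals $1$ for $i=1$ and $0$ for $2\le i\le n$. The empty face counts as a face of dimension $-1$, and the polytope itself counts as a face. $F(t,x)$ is understood as a formal power series in $t$ whose coefficients are Laurent polynomials in $x$ (each factor is expanded as a geometric series in $t$, and $\frac{1}{x-xt}=\frac1x\sum_{n\ge0}t^n$). *)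

theory Defs
  imports "HOL-Analysis.Analysis" "HOL-Computational_Algebra.Formal_Laurent_Series"
begin

text \<open>
  The vertex \<open>v\<^sub>i\<close> is represented by the natural number \<open>i\<close>, so that \<open>K_edges (n + 1)\<close> is the
  edge set of \<open>K\<^bsub>n+1\<^esub>\<close>.
\<close>

definition K_edges :: "nat \<Rightarrow> (nat \<times> nat) set" where
  "K_edges m = {(i, j). 1 \<le> i \<and> i < j \<and> j \<le> m}"

text \<open>
  The space of real functions on the edge set of \<open>K\<^bsub>n+1\<^esub>\<close> depends on the number \<open>n\<close>. To have it as
  a Euclidean space, we write it as \<open>real ^ 'e\<close>, where \<open>'e\<close> is a finite type whose elements are
  identified with the edges by a bijection \<open>e\<close>: the component \<open>f $ k\<close> is the value of the function
  \<open>f\<close> on the edge \<open>e k\<close>. For every \<open>n \<ge> 1\<close> the edge set is finite and nonempty, so such types exist.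
\<close>

definition edge_labelling :: "('e::finite \<Rightarrow> nat \<times> nat) \<Rightarrow> nat \<Rightarrow> bool" where
  "edge_labelling e n \<longleftrightarrow> bij_betw e UNIV (K_edges (n + 1))"

text \<open>
  Only the net flows at \<open>v\<^sub>1, \<dots>, v\<^sub>n\<close> are prescribed; the one at \<open>v\<^bsub>n+1\<^esub>\<close> is then determined.
\<close>

definition Flow :: "('e::finite \<Rightarrow> nat \<times> nat) \<Rightarrow> nat \<Rightarrow> (nat \<Rightarrow> real) \<Rightarrow> (real ^ 'e) set" where
  "Flow e n a = {f. (\<forall>k. 0 \<le> f $ k) \<and>
     (\<forall>i\<in>{1..n}. (\<Sum>k | fst (e k) = i. f $ k) - (\<Sum>k | snd (e k) = i. f $ k) = a i)}"

definition CRY :: "('e::finite \<Rightarrow> nat \<times> nat) \<Rightarrow> nat \<Rightarrow> (real ^ 'e) set" where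
  "CRY e n = Flow e n (\<lambda>i. if i = 1 then 1 else 0)"

text \<open>
  In the library, the empty set and the polytope itself are faces, and \<open>aff_dim {} = - 1\<close>.
\<close>

definition num_faces :: "'a::euclidean_space set \<Rightarrow> int \<Rightarrow> nat" where
  "num_faces P d = card {T. T face_of P \<and> aff_dim T = d}"

text \<open>
  \<open>face_gf\<close> is the series \<open>F(t, x)\<close>, a power series in \<open>t = fps_X\<close> over the field of formal
  Laurent series in \<open>fls_X\<close>, which contains the Laurent polynomials. All denominators have an
  invertible constant coefficient with respect to \<open>t\<close>, so division is expansion as a geometric
  series in \<open>t\<close>. The infinite sum is taken in the \<open>t\<close>-adic topology, which is the library's
  topology on \<open>fps\<close>.
\<close>

definition face_gf :: "rat fls fps" where
  "face_gf = (let t = fps_X; x = fps_const fls_X in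
     1 / (x - x * t) +
     (\<Sum>n. t ^ n * inverse x ^ n *
        (\<Prod>i=1..n. ((1 + x) ^ i - 1) / (1 + ((1 + x) ^ i - 1 - x) * t * inverse x))))"

end

theory Submission
  imports Defs
begin

text \<open>
  A nonempty face of the polytope consists of the flows supported in a set \<open>E\<close> of edges, where \<open>E\<close> is
  the support of a flow. These supports are the edge sets in which the sink has an in-edge and every
  inner vertex has an in-edge if and only if it has an out-edge. The dimension of the face is the
  number of edges of \<open>E\<close> minus the number of tails of \<open>E\<close>, which equals the number of heads.

  To count these edge sets, let \<open>A\<close> be a set of vertices before \<open>j\<close> that may send edges to
  \<open>j, \<dots>, n + 1\<close> without being obliged to, and decide on the set of in-edges of \<open>j\<close>. If it is
  empty, then \<open>j\<close> is not used. Otherwise \<open>j\<close> needs an out-edge, and the edge sets with this property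
  are those counted for \<open>A \<union> {j}\<close> minus those counted for \<open>A\<close>. Hence the weighted count depends
  only on \<open>c = card A\<close> and on the number of remaining vertices, and its generating function
  satisfies \<open>\<Psi>\<^sub>c = 1 + K\<^sub>c \<Psi>\<^bsub>c+1\<^esub>\<close> with \<open>K\<^sub>c\<close> a multiple of \<open>t\<close>. Iterating gives the sum of products.
\<close>

section \<open>Counting edge sets\<close>

text \<open>The vertices before \<open>j\<close> have been dealt with: those in \<open>A\<close> may
  still be tails, and no balance is demanded of them. The supports of flows are the case
  \<open>N = n + 1\<close>, \<open>j = 2\<close>, \<open>A = {1}\<close>.\<close>

definition edge_sets :: "nat \<Rightarrow> nat \<Rightarrow> nat set \<Rightarrow> (nat \<times> nat) set set" where
  "edge_sets N j A = {E. (\<forall>(a, b)\<in>E. (a \<in> A \<or> j \<le> a) \<and> a < b \<and> j \<le> b \<and> b \<le> N) \<and>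
     (\<exists>a. (a, N) \<in> E) \<and>
     (\<forall>v. j \<le> v \<longrightarrow> v < N \<longrightarrow> (\<exists>a. (a, v) \<in> E) = (\<exists>b. (v, b) \<in> E))}"

text \<open>Subtracting heads rather than tails makes this additive over the in-stars of the heads:
  a nonempty star with \<open>k\<close> edges contributes \<open>k - 1\<close>.\<close>

definition excess :: "(nat \<times> nat) set \<Rightarrow> int" where
  "excess E = int (card E) - int (card (snd ` E))"

definition weight_sum :: "'a::field \<Rightarrow> nat \<Rightarrow> nat \<Rightarrow> nat set \<Rightarrow> 'a" where
  "weight_sum x N j A = (\<Sum>E\<in>edge_sets N j A. x powi excess E)"

text \<open>Generating function, by excess, of the nonempty in-stars of one vertex with
  \<open>c\<close> admissible tails.\<close>

definition star_weight :: "'a::field \<Rightarrow> nat \<Rightarrow> 'a" where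
  "star_weight x c = ((1 + x) ^ c - 1) / x"

lemma edge_setsD:
  assumes "E \<in> edge_sets N j A" "(a, b) \<in> E"
  shows "a \<in> A \<or> j \<le> a" "a < b" "j \<le> b" "b \<le> N"
  using assms by (auto simp: edge_sets_def)

lemma finite_edge_sets:
  assumes "finite A" shows "finite (edge_sets N j A)"
proof (rule finite_subset)
  show "edge_sets N j A \<subseteq> Pow ((A \<union> {..N}) \<times> {..N})"
    by (fastforce simp: edge_sets_def)
  show "finite (Pow ((A \<union> {..N}) \<times> {..N}))" using assms by simp
qed

lemma finite_in_edge_sets:
  assumes "finite A" "E \<in> edge_sets N j A" shows "finite E"
proof (rule finite_subset)
  show "E \<subseteq> (A \<union> {..N}) \<times> {..N}"
    using assms by (fastforce simp: edge_sets_def)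
  show "finite ((A \<union> {..N}) \<times> {..N})" using assms by simp
qed

lemma sum_power_card_Pow:
  fixes x :: "'a::comm_semiring_1"
  assumes "finite A"
  shows "(\<Sum>I\<in>Pow A. x ^ card I) = (1 + x) ^ card A"
  using assms
proof induction
  case (insert a A)
  have inj: "inj_on (insert a) (Pow A)"
    using insert(2) by (auto simp: inj_on_def)
  have "(\<Sum>I\<in>Pow (insert a A). x ^ card I) =
      (\<Sum>I\<in>Pow A. x ^ card I) + (\<Sum>I\<in>insert a ` Pow A. x ^ card I)"
    unfolding Pow_insert using insert by (intro sum.union_disjoint) auto
  also have "(\<Sum>I\<in>insert a ` Pow A. x ^ card I) = (\<Sum>I\<in>Pow A. x ^ card (insert a I))"
    using inj by (simp add: sum.reindex)
  also have "\<dots> = (\<Sum>I\<in>Pow A. x * x ^ card I)"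
  proof (rule sum.cong)
    fix I assume "I \<in> Pow A"
    then have "finite I" "a \<notin> I" using insert finite_subset by auto
    then show "x ^ card (insert a I) = x * x ^ card I" by simp
  qed simp
  finally show ?case
    using insert by (simp add: sum_distrib_left[symmetric] algebra_simps)
qed simp

lemma sum_nonempty_subsets:
  assumes "finite A" "x \<noteq> 0"
  shows "(\<Sum>I\<in>Pow A - {{}}. x powi (int (card I) - 1)) = star_weight x (card A)"
proof -
  have "(\<Sum>I\<in>Pow A - {{}}. x powi (int (card I) - 1)) = (\<Sum>I\<in>Pow A - {{}}. x ^ card I) / x"
    using assms(2) by (simp add: power_int_diff sum_divide_distrib)
  also have "(\<Sum>I\<in>Pow A - {{}}. x ^ card I) = (1 + x) ^ card A - 1"
    using assms(1) by (simp add: sum_diff1 sum_power_card_Pow)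
  finally show ?thesis by (simp add: star_weight_def)
qed

text \<open>With only the sink left there is no inner vertex to balance, so the edge sets are
  exactly the nonempty stars \<open>I \<times> {N}\<close>.\<close>

lemma weight_sum_last:
  assumes "finite A" "A \<subseteq> {..<N}" "x \<noteq> 0"
  shows "weight_sum x N N A = star_weight x (card A)"
proof -
  have "bij_betw (\<lambda>I. I \<times> {N}) (Pow A - {{}}) (edge_sets N N A)"
  proof (rule bij_betwI[where g = "\<lambda>E. fst ` E"])
    show "(\<lambda>I. I \<times> {N}) \<in> (Pow A - {{}}) \<rightarrow> edge_sets N N A"
      using assms(2) by (auto simp: edge_sets_def)
    show "(\<lambda>E. fst ` E) \<in> edge_sets N N A \<rightarrow> Pow A - {{}}"
      by (fastforce simp: edge_sets_def)
    show "fst ` E \<times> {N} = E" if E: "E \<in> edge_sets N N A" for E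
    proof -
      have "b = N" if "(a, b) \<in> E" for a b using edge_setsD[OF E that] by simp
      then show ?thesis by force
    qed
  qed auto
  then have "weight_sum x N N A = (\<Sum>I\<in>Pow A - {{}}. x powi excess (I \<times> {N}))"
    unfolding weight_sum_def by (rule sum.reindex_bij_betw[symmetric])
  also have "\<dots> = (\<Sum>I\<in>Pow A - {{}}. x powi (int (card I) - 1))"
    by (intro sum.cong) (auto simp: excess_def card_cartesian_product snd_image_times)
  finally show ?thesis using sum_nonempty_subsets[OF assms(1,3)] by simp
qed

section \<open>Removing the first undecided vertex\<close>

text \<open>The balance conditions start at \<open>Suc j\<close>, so placing \<open>j\<close> among
  the admissible tails imposes nothing on it; leaving it out merely forbids its out-edges.\<close>

lemma edge_sets_Suc_iff_no_out:
  assumes "A \<subseteq> {..<j}"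
  shows "E \<in> edge_sets N (Suc j) A \<longleftrightarrow>
    E \<in> edge_sets N (Suc j) (insert j A) \<and> (\<forall>b. (j, b) \<notin> E)"
  using assms unfolding edge_sets_def by auto

text \<open>Without in-edges the balance condition at \<open>j\<close> excludes out-edges as well,
  so \<open>j\<close> is isolated. In the other direction, \<open>j\<close> is neither an admissible
  tail nor an admissible head.\<close>

lemma edge_sets_Suc_iff_no_in:
  assumes "A \<subseteq> {..<j}" "j < N"
  shows "E \<in> edge_sets N (Suc j) A \<longleftrightarrow> E \<in> edge_sets N j A \<and> (\<forall>a. (a, j) \<notin> E)"
proof (intro iffI conjI)
  assume E: "E \<in> edge_sets N (Suc j) A"
  note D = edge_setsD[OF E]
  show no: "\<forall>a. (a, j) \<notin> E" using D(3) by fastforce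
  have "(j, b) \<notin> E" for b using D(1)[of j b] assms by auto
  moreover have "v = j \<or> Suc j \<le> v" if "j \<le> v" for v using that by auto
  ultimately show "E \<in> edge_sets N j A"
    using E no unfolding edge_sets_def by (auto intro: Suc_leD) metis+
next
  assume E: "E \<in> edge_sets N j A \<and> (\<forall>a. (a, j) \<notin> E)"
  then have "(j, b) \<notin> E" for b using assms by (auto simp: edge_sets_def)
  then show "E \<in> edge_sets N (Suc j) A"
    using E unfolding edge_sets_def by (auto simp: Suc_le_eq nat_less_le)
qed

text \<open>The star ends in \<open>j\<close> and its tails precede \<open>j\<close>, so it affects
  no condition at a later vertex. At \<open>j\<close> it supplies in-edges, and the balance
  condition turns into the demand for an out-edge.\<close>

lemma edge_sets_insert_star_iff:
  assumes "A \<subseteq> {..<j}" "j < N" "I \<subseteq> A" "I \<noteq> {}" "\<forall>a. (a, j) \<notin> E"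
  shows "I \<times> {j} \<union> E \<in> edge_sets N j A \<longleftrightarrow>
    E \<in> edge_sets N (Suc j) (insert j A) \<and> (\<exists>b. (j, b) \<in> E)"
proof -
  let ?E = "I \<times> {j} \<union> E"
  have 1: "(\<exists>a. (a, v) \<in> ?E) \<longleftrightarrow> v = j \<or> (\<exists>a. (a, v) \<in> E)" for v
    using assms(4) by auto
  have 2: "(\<exists>b. (v, b) \<in> ?E) \<longleftrightarrow> (\<exists>b. (v, b) \<in> E)" if "j \<le> v" for v
    using assms(1,3) that by auto
  have 3: "(\<forall>(a, b)\<in>?E. (a \<in> A \<or> j \<le> a) \<and> a < b \<and> j \<le> b \<and> b \<le> N) \<longleftrightarrow>
     (\<forall>(a, b)\<in>E. (a \<in> insert j A \<or> Suc j \<le> a) \<and> a < b \<and> Suc j \<le> b \<and> b \<le> N)"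
  proof -
    have "((a \<in> A \<or> j \<le> a) \<and> a < b \<and> j \<le> b \<and> b \<le> N) \<longleftrightarrow>
        ((a \<in> insert j A \<or> Suc j \<le> a) \<and> a < b \<and> Suc j \<le> b \<and> b \<le> N)" if "(a, b) \<in> E" for a b
    proof -
      have "b \<noteq> j" using assms(5) that by auto
      then show ?thesis by auto
    qed
    moreover have "(a \<in> A \<or> j \<le> a) \<and> a < j \<and> j \<le> j \<and> j \<le> N" if "a \<in> I" for a
      using assms that by auto
    ultimately show ?thesis by (simp add: ball_Un Ball_def) blast
  qed
  have 4: "j \<le> v \<longleftrightarrow> v = j \<or> Suc j \<le> v" for v by auto
  have "(\<forall>v. j \<le> v \<longrightarrow> v < N \<longrightarrow> (\<exists>a. (a, v) \<in> ?E) = (\<exists>b. (v, b) \<in> ?E)) \<longleftrightarrow>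
     (\<exists>b. (j, b) \<in> E) \<and> (\<forall>v. Suc j \<le> v \<longrightarrow> v < N \<longrightarrow> (\<exists>a. (a, v) \<in> E) = (\<exists>b. (v, b) \<in> E))"
    (is "?l = ?r")
  proof
    assume l: ?l
    show ?r
    proof (intro conjI allI impI)
      show "\<exists>b. (j, b) \<in> E" using l[rule_format, of j] 1[of j] 2[of j] assms(2) by simp
      show "(\<exists>a. (a, v) \<in> E) = (\<exists>b. (v, b) \<in> E)" if "Suc j \<le> v" "v < N" for v
        using l[rule_format, of v] 1[of v] 2[of v] that by simp
    qed
  next
    assume r: ?r
    show ?l
    proof (intro allI impI)
      fix v assume "j \<le> v" "v < N"
      then show "(\<exists>a. (a, v) \<in> ?E) = (\<exists>b. (v, b) \<in> ?E)"
        unfolding 1 2[OF \<open>j \<le> v\<close>] using r 4[of v] by blast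
    qed
  qed
  then show ?thesis
    unfolding edge_sets_def mem_Collect_eq 3 1 using assms(2) by auto
qed

text \<open>The edge sets are split by whether \<open>j\<close> has an in-edge. If so, the in-star
  of \<open>j\<close> and the remaining edges are chosen independently, the latter among the edge
  sets with \<open>j\<close> as a tail; these form the difference \<open>D\<close>. The three claims
  are what splitting a sum requires.\<close>

lemma edge_sets_step:
  assumes A: "A \<subseteq> {..<j}" and j: "j < N"
  defines "D \<equiv> edge_sets N (Suc j) (insert j A) - edge_sets N (Suc j) A"
  shows "edge_sets N j A = edge_sets N (Suc j) A \<union>
      (\<lambda>(I, E). I \<times> {j} \<union> E) ` ((Pow A - {{}}) \<times> D)" (is "?L = ?R1 \<union> ?f ` ?P")
    and "edge_sets N (Suc j) A \<inter> (\<lambda>(I, E). I \<times> {j} \<union> E) ` ((Pow A - {{}}) \<times> D) = {}"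
    and "inj_on (\<lambda>(I, E). I \<times> {j} \<union> E) ((Pow A - {{}}) \<times> D)"
proof -
  have D: "E \<in> D \<longleftrightarrow> E \<in> edge_sets N (Suc j) (insert j A) \<and> (\<exists>b. (j, b) \<in> E)" for E
    unfolding D_def using edge_sets_Suc_iff_no_out[OF A] by auto
  have no_j: "(a, j) \<notin> E" if "E \<in> edge_sets N (Suc j) B" for E B a
    using edge_setsD(3)[OF that, of a j] by auto
  show "?L = ?R1 \<union> ?f ` ?P"
  proof (intro equalityI subsetI)
    fix E assume E: "E \<in> ?L"
    show "E \<in> ?R1 \<union> ?f ` ?P"
    proof (cases "\<forall>a. (a, j) \<notin> E")
      case True
      then show ?thesis using E edge_sets_Suc_iff_no_in[OF A j] by simp
    next
      case False
      define I where "I = {a. (a, j) \<in> E}"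
      define E' where "E' = {p \<in> E. snd p \<noteq> j}"
      have I: "I \<subseteq> A" "I \<noteq> {}"
        using False edge_setsD[OF E] by (fastforce simp: I_def)+
      have EE: "E = I \<times> {j} \<union> E'" and nE': "\<forall>a. (a, j) \<notin> E'"
        by (auto simp: I_def E'_def)
      have "E' \<in> D"
        unfolding D edge_sets_insert_star_iff[OF A j I nE', symmetric] using E EE by simp
      then show ?thesis using EE I by auto
    qed
  next
    fix E assume "E \<in> ?R1 \<union> ?f ` ?P"
    then show "E \<in> ?L"
    proof
      assume "E \<in> ?R1"
      then show ?thesis using edge_sets_Suc_iff_no_in[OF A j] by simp
    next
      assume "E \<in> ?f ` ?P"
      then obtain I E' where E: "E = I \<times> {j} \<union> E'" and I: "I \<subseteq> A" "I \<noteq> {}" and E': "E' \<in> D"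
        by auto
      have "\<forall>a. (a, j) \<notin> E'" using E' no_j unfolding D by blast
      then show ?thesis
        unfolding E using E' edge_sets_insert_star_iff[OF A j I] by (simp add: D)
    qed
  qed
  show "?R1 \<inter> ?f ` ?P = {}"
    using no_j by fastforce
  show "inj_on ?f ?P"
  proof (rule inj_onI)
    fix p q assume "p \<in> ?P" "q \<in> ?P" "?f p = ?f q"
    then obtain I E I' E' where pq: "p = (I, E)" "q = (I', E')"
      and *: "E \<in> D" "E' \<in> D" "I \<times> {j} \<union> E = I' \<times> {j} \<union> E'"
      by (cases p; cases q) auto
    \<comment> \<open>The edges entering \<open>j\<close> recover the star, and all other edges
      recover the rest.\<close>
    then have nj: "(a, j) \<notin> E" "(a, j) \<notin> E'" for a using no_j unfolding D by blast+
    have "I = I'"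
    proof (intro set_eqI)
      fix a show "a \<in> I \<longleftrightarrow> a \<in> I'"
        using nj[of a] arg_cong[OF *(3), of "\<lambda>E. (a, j) \<in> E"] by simp
    qed
    moreover have "E = E'"
    proof (intro set_eqI)
      fix p :: "nat \<times> nat" show "p \<in> E \<longleftrightarrow> p \<in> E'"
        using nj[of "fst p"] arg_cong[OF *(3), of "\<lambda>E. p \<in> E"] by (cases p; cases "snd p = j") auto
    qed
    ultimately show "p = q" using pq by simp
  qed
qed

text \<open>A star adds \<open>card I\<close> edges and the single new head \<open>j\<close>, so the
  weights multiply and the sum over pairs factors.\<close>

lemma weight_sum_step:
  assumes A: "A \<subseteq> {..<j}" and j: "j < N" and x: "x \<noteq> 0"
  shows "weight_sum x N j A = weight_sum x N (Suc j) A +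
    star_weight x (card A) * (weight_sum x N (Suc j) (insert j A) - weight_sum x N (Suc j) A)"
proof -
  define D where "D = edge_sets N (Suc j) (insert j A) - edge_sets N (Suc j) A"
  let ?f = "\<lambda>(I, E). I \<times> {j} \<union> E :: (nat \<times> nat) set"
  let ?P = "(Pow A - {{}}) \<times> D"
  have fA: "finite A" using A by (rule finite_subset) simp
  have fin: "finite (edge_sets N (Suc j) (insert j A))" "finite (edge_sets N (Suc j) A)"
    using fA finite_edge_sets by auto
  have fD: "finite D" using fin by (simp add: D_def)
  have ex: "excess (I \<times> {j} \<union> E) = (int (card I) - 1) + excess E"
    if "I \<in> Pow A - {{}}" "E \<in> D" for I E
  proof -
    have E: "E \<in> edge_sets N (Suc j) (insert j A)" using that by (simp add: D_def)
    have "finite I" "finite E"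
      using that fA E finite_in_edge_sets[of "insert j A"] by (auto intro: finite_subset)
    have "j \<notin> snd ` E" using edge_setsD(3)[OF E] by fastforce
    have "(I \<times> {j}) \<inter> E = {}" using \<open>j \<notin> snd ` E\<close> by force
    then have "card (I \<times> {j} \<union> E) = card I + card E"
      using \<open>finite I\<close> \<open>finite E\<close> by (simp add: card_Un_disjoint card_cartesian_product)
    moreover have "snd ` (I \<times> {j} \<union> E) = insert j (snd ` E)"
      using that by (auto simp: image_Un snd_image_times)
    ultimately show ?thesis
      using \<open>j \<notin> snd ` E\<close> \<open>finite E\<close> by (simp add: excess_def)
  qed
  have "weight_sum x N j A = weight_sum x N (Suc j) A + (\<Sum>p\<in>?f ` ?P. x powi excess p)"
    unfolding weight_sum_def edge_sets_step(1)[OF A j, folded D_def]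
    using edge_sets_step(2)[OF A j, folded D_def] fin fD fA
    by (intro sum.union_disjoint) auto
  also have "(\<Sum>p\<in>?f ` ?P. x powi excess p) = (\<Sum>p\<in>?P. x powi excess (?f p))"
    using edge_sets_step(3)[OF A j, folded D_def] by (simp add: sum.reindex)
  also have "\<dots> = (\<Sum>(I, E)\<in>?P. x powi (int (card I) - 1) * x powi excess E)"
  proof (rule sum.cong)
    fix p assume "p \<in> ?P"
    then show "x powi excess (?f p) = (case p of (I, E) \<Rightarrow> x powi (int (card I) - 1) * x powi excess E)"
      using x ex[of "fst p" "snd p"] by (simp add: split_beta mem_Times_iff flip: power_int_add)
  qed simp
  also have "\<dots> = star_weight x (card A) * (\<Sum>E\<in>D. x powi excess E)"
    by (simp add: sum_product sum.cartesian_product sum_nonempty_subsets[OF fA x, symmetric])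
  also have "(\<Sum>E\<in>D. x powi excess E) =
      weight_sum x N (Suc j) (insert j A) - weight_sum x N (Suc j) A"
    unfolding D_def weight_sum_def using fin edge_sets_Suc_iff_no_out[OF A] by (intro sum_diff) auto
  finally show ?thesis .
qed

section \<open>The recursion and its generating function\<close>

text \<open>Here \<open>m\<close> counts the vertices from \<open>j\<close> to the one before the
  sink, and \<open>c\<close> is the size of \<open>A\<close>, through which alone \<open>A\<close>
  enters the count.\<close>

fun weight_rec :: "'a::field \<Rightarrow> nat \<Rightarrow> nat \<Rightarrow> 'a" where
  "weight_rec x 0 c = star_weight x c"
| "weight_rec x (Suc m) c =
     (1 - star_weight x c) * weight_rec x m c + star_weight x c * weight_rec x m (Suc c)"

lemma weight_sum_eq_rec:
  assumes "A \<subseteq> {..<j}" "x \<noteq> 0"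
  shows "weight_sum x (j + m) j A = weight_rec x m (card A)"
  using assms
proof (induction m arbitrary: j A)
  case 0
  then show ?case by (simp add: weight_sum_last finite_subset[of A "{..<j}"])
next
  case (Suc m)
  have "finite A" "j \<notin> A" using Suc.prems by (auto intro: finite_subset)
  moreover have "A \<subseteq> {..<Suc j}" "insert j A \<subseteq> {..<Suc j}" using Suc.prems by auto
  moreover note Suc.IH[of A "Suc j"] Suc.IH[of "insert j A" "Suc j"]
  ultimately show ?case
    using Suc.prems by (simp add: weight_sum_step algebra_simps)
qed

context
  fixes x :: "'a::field"
begin

text \<open>This is \<open>K\<^sub>c\<close>. With \<open>x\<close> the Laurent variable it equals
  \<open>t / x\<close> times the \<open>c\<close>-th factor of the product in
  \<open>F\<close>.\<close>

definition step_factor :: "nat \<Rightarrow> 'a fps" where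
  "step_factor c = fps_X * fps_const (star_weight x c) / (1 + fps_const (star_weight x c - 1) * fps_X)"

text \<open>This is \<open>\<Psi>\<^sub>c\<close>. The shift by one power of \<open>t\<close>
  matches \<open>n = m + 1\<close>, and the constant term provides the empty product.\<close>

definition rec_gf :: "nat \<Rightarrow> 'a fps" where
  "rec_gf c = 1 + fps_X * Abs_fps (\<lambda>m. weight_rec x m c)"

text \<open>With \<open>v = star_weight x c\<close>, the recursion reads
  \<open>P c = v + t ((1 - v) P c + v P (c + 1))\<close>. Hence
  \<open>(1 + (v - 1) t) P c = v (1 + t P (c + 1))\<close>, where the factor on the left has
  constant coefficient 1 and is invertible.\<close>

lemma rec_gf_step: "rec_gf c = 1 + step_factor c * rec_gf (Suc c)"
proof -
  define v where "v = star_weight x c"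
  define P where "P c = Abs_fps (\<lambda>m. weight_rec x m c)" for c
  define w where "w = fps_const (v - 1)"
  define d where "d = 1 + w * fps_X"
  have d0: "fps_nth d 0 \<noteq> 0" by (simp add: d_def w_def)
  have P: "P c = fps_const v + fps_X * (fps_const (1 - v) * P c + fps_const v * P (Suc c))"
  proof (rule fps_ext)
    fix m show "fps_nth (P c) m =
        fps_nth (fps_const v + fps_X * (fps_const (1 - v) * P c + fps_const v * P (Suc c))) m"
      by (cases m) (simp_all add: P_def v_def)
  qed
  have fc: "fps_const (1 - v) = - w" by (simp add: w_def)
  have "d * P c = fps_const v * rec_gf (Suc c)"
    using P unfolding d_def rec_gf_def P_def[symmetric] fc by (simp add: algebra_simps)
  then have "d * (fps_X * P c) = fps_X * fps_const v * rec_gf (Suc c)"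
    by (simp add: algebra_simps)
  then have "inverse d * d * (fps_X * P c) = inverse d * (fps_X * fps_const v * rec_gf (Suc c))"
    by (simp only: mult.assoc)
  then have "fps_X * P c = fps_X * fps_const v / d * rec_gf (Suc c)"
    unfolding fps_divide_unit[OF d0] inverse_mult_eq_1[OF d0] by (simp only: mult_1_left ac_simps)
  then show ?thesis by (simp add: rec_gf_def[of c] P_def[of c] step_factor_def v_def d_def w_def)
qed

lemma rec_gf_telescope:
  "rec_gf 1 = (\<Sum>m<k. \<Prod>i=1..m. step_factor i) + (\<Prod>i=1..k. step_factor i) * rec_gf (Suc k)"
proof (induction k)
  case (Suc k)
  then show ?case using rec_gf_step[of "Suc k"] by (simp add: algebra_simps)
qed simp

text \<open>Each factor is a multiple of \<open>t\<close>, so the product of \<open>k\<close> of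
  them is a multiple of \<open>t ^ k\<close>.\<close>

lemma prod_step_factor_nth:
  assumes "m < k" shows "fps_nth ((\<Prod>i=1..k. step_factor i) * g) m = 0"
proof -
  have "step_factor i = fps_X * (fps_const (star_weight x i) / (1 + fps_const (star_weight x i - 1) * fps_X))"
    for i by (simp add: step_factor_def fps_divide_unit mult.assoc)
  then have "(\<Prod>i=1..k. step_factor i) = fps_X ^ k *
      (\<Prod>i=1..k. fps_const (star_weight x i) / (1 + fps_const (star_weight x i - 1) * fps_X))"
    by (simp add: prod.distrib)
  then show ?thesis using assms by (simp add: mult.assoc fps_X_power_mult_nth)
qed

text \<open>The remainder in \<open>rec_gf_telescope\<close> has no terms below
  \<open>t ^ k\<close>. So each coefficient of the partial sums is eventually constant, which is
  \<open>t\<close>-adic convergence.\<close>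

lemma step_factor_sums: "(\<lambda>m. \<Prod>i=1..m. step_factor i) sums rec_gf 1"
  unfolding sums_def
proof (rule tendsto_fpsI)
  fix m
  show "eventually (\<lambda>k. fps_nth (\<Sum>m<k. \<Prod>i=1..m. step_factor i) m = fps_nth (rec_gf 1) m) sequentially"
    using eventually_gt_at_top[of m]
  proof eventually_elim
    case (elim k)
    then show ?case by (subst rec_gf_telescope[of k]) (simp only: fps_add_nth prod_step_factor_nth add_0_right)
  qed
qed

end

section \<open>Comparison with the series F(t, x)\<close>

text \<open>The power \<open>t ^ n * inverse x ^ n\<close> is distributed over the \<open>n\<close>
  factors of the product, which turns the \<open>i\<close>-th one into
  \<open>step_factor fls_X i\<close>.\<close>

lemma face_gf_eq:
  "face_gf = 1 / (fps_const fls_X - fps_const fls_X * fps_X) + rec_gf fls_X 1"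
proof -
  define x :: "rat fls fps" where "x = fps_const fls_X"
  define y where "y = inverse x"
  have y: "y = fps_const (inverse fls_X)"
    by (simp add: y_def x_def fps_const_inverse)
  have xy: "x * y = 1"
    unfolding y_def by (rule inverse_mult_eq_1') (simp add: x_def)
  have "fps_X * y * (((1 + x) ^ i - 1) / (1 + ((1 + x) ^ i - 1 - x) * fps_X * y)) =
      step_factor fls_X i" for i
  proof -
    define u where "u = (1 + x) ^ i - 1"
    have "u = fps_const ((1 + fls_X) ^ i - 1)"
      by (simp add: u_def x_def fps_const_power[symmetric] fps_const_add[symmetric]
          fps_const_sub[symmetric] del: fps_const_add fps_const_sub fps_const_power)
    then have uy: "u * y = fps_const (star_weight fls_X i)"
      unfolding y by (simp add: star_weight_def divide_inverse)
    have "(u - x) * fps_X * y = (u * y - x * y) * fps_X"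
      by (simp add: algebra_simps)
    then have den: "(u - x) * fps_X * y = fps_const (star_weight fls_X i - 1) * fps_X"
      unfolding uy xy by simp
    have eq: "fps_X * y * (u * z) = fps_X * fps_const (star_weight fls_X i) * z" for z
      unfolding uy[symmetric] by (simp only: ac_simps)
    show ?thesis
      unfolding u_def[symmetric] den step_factor_def by (simp add: fps_divide_unit eq)
  qed
  moreover have "fps_X ^ n * y ^ n * prod f {1..n} = (\<Prod>i=1..n. fps_X * y * f i)" for n f
    by (simp add: prod.distrib power_mult_distrib)
  ultimately show ?thesis
    unfolding face_gf_def Let_def x_def[symmetric] y_def[symmetric]
    by (simp only: step_factor_sums[THEN sums_unique, symmetric])
qed

text \<open>All coefficients of \<open>1 / (x - x * t)\<close> in \<open>t\<close> are
  \<open>1 / x\<close>; this term accounts for the empty face, of dimension -1.\<close>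

lemma face_gf_nth:
  assumes "n \<ge> 1"
  shows "fps_nth face_gf n = inverse fls_X + weight_sum fls_X (n + 1) 2 {1}"
proof -
  have "fps_const fls_X - fps_const fls_X * fps_X = fps_const (fls_X :: rat fls) * (1 - fps_X)"
    by (simp add: algebra_simps)
  then have "1 / (fps_const fls_X - fps_const fls_X * fps_X) = fps_const (inverse (fls_X :: rat fls)) * inverse (1 - fps_X)"
    by (simp only:) (simp add: fps_divide_unit fps_inverse_mult fps_const_inverse)
  moreover have inv1: "inverse (1 - fps_X :: rat fls fps) = Abs_fps (\<lambda>_. 1)"
    by (rule fps_inverse_unique) (simp add: fps_eq_iff left_diff_distrib fps_X_mult_nth[abs_def] del: fps_X_mult_nth)
  moreover obtain m where m: "n = Suc m" using assms by (cases n) auto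
  ultimately have "fps_nth face_gf n = inverse fls_X + weight_rec fls_X m 1"
    unfolding face_gf_eq by (simp add: rec_gf_def inv1)
  \<comment> \<open>There are \<open>m = n - 1\<close> inner vertices \<open>2, ..., n\<close>, and
    initially vertex 1 is the only admissible tail.\<close>
  moreover have "weight_sum (fls_X :: rat fls) (2 + m) 2 {1} = weight_rec fls_X m 1"
    by (subst weight_sum_eq_rec) auto
  ultimately show ?thesis using m by simp
qed

lemma fls_nth_weight_sum:
  assumes "finite A"
  shows "fls_nth (weight_sum (fls_X :: 'a::field fls) N j A) d =
    of_nat (card {E \<in> edge_sets N j A. excess E = d})"
proof -
  have "fls_nth (weight_sum (fls_X :: 'a fls) N j A) d = (\<Sum>E\<in>edge_sets N j A. of_bool (excess E = d))"
    unfolding weight_sum_def fls_nth_sum by (intro sum.cong) (auto simp: fls_X_power_int)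
  also have "\<dots> = of_nat (card {E \<in> edge_sets N j A. excess E = d})"
    using finite_edge_sets[OF assms] by (simp add: of_bool_def sum.If_cases Int_def)
  finally show ?thesis .
qed

section \<open>Faces of polyhedra in standard form\<close>

definition support :: "'a::zero ^ 'e \<Rightarrow> 'e set" where
  "support f = {k. f $ k \<noteq> 0}"

lemma support_subset_iff: "support f \<subseteq> S \<longleftrightarrow> (\<forall>k. k \<notin> S \<longrightarrow> f $ k = 0)"
  by (auto simp: support_def)

lemma nth_eq_0_outside_support: "support f \<subseteq> S \<Longrightarrow> k \<notin> S \<Longrightarrow> f $ k = 0"
  by (auto simp: support_def)

definition orthant_part :: "(real ^ 'e) set \<Rightarrow> (real ^ 'e) set" where
  "orthant_part L = {f \<in> L. \<forall>k. 0 \<le> f $ k}"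

text \<open>Different sets \<open>S\<close> may cut out the same face. Each nonempty face arises
  exactly once when \<open>S\<close> ranges over the supports of points of the polyhedron.\<close>

definition support_face :: "(real ^ 'e) set \<Rightarrow> 'e set \<Rightarrow> (real ^ 'e) set" where
  "support_face L S = {f \<in> orthant_part L. support f \<subseteq> S}"

context
  fixes L :: "(real ^ 'e) set"
  assumes L: "affine L"
begin

lemma convex_orthant_part: "convex (orthant_part L)"
proof (rule convexI)
  fix x y and u v :: real
  assume "x \<in> orthant_part L" "y \<in> orthant_part L" "0 \<le> u" "0 \<le> v" "u + v = 1"
  then show "u *\<^sub>R x + v *\<^sub>R y \<in> orthant_part L"
    using mem_affine[OF L, of x y u v] by (auto simp: orthant_part_def)
qed

text \<open>If a combination of nonnegative numbers with positive weights vanishes, then so do the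
  numbers; this applies to every coordinate outside \<open>S\<close>.\<close>

lemma support_face_face_of: "support_face L S face_of orthant_part L"
  unfolding face_of_def
proof (intro conjI ballI impI)
  show "support_face L S \<subseteq> orthant_part L" by (auto simp: support_face_def)
  show "convex (support_face L S)"
  proof (rule convexI)
    fix x y and u v :: real
    assume *: "x \<in> support_face L S" "y \<in> support_face L S" "0 \<le> u" "0 \<le> v" "u + v = 1"
    then have "u *\<^sub>R x + v *\<^sub>R y \<in> orthant_part L"
      using convexD[OF convex_orthant_part, of x y u v] by (simp add: support_face_def)
    then show "u *\<^sub>R x + v *\<^sub>R y \<in> support_face L S"
      using * by (simp add: support_face_def support_subset_iff)
  qed
  fix a b x
  assume a: "a \<in> orthant_part L" and b: "b \<in> orthant_part L" and x: "x \<in> support_face L S"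
    and "x \<in> open_segment a b"
  then obtain u where u: "0 < u" "u < 1" "x = (1 - u) *\<^sub>R a + u *\<^sub>R b"
    by (auto simp: in_segment)
  have "a $ k = 0 \<and> b $ k = 0" if "k \<notin> S" for k
  proof -
    have "0 = (1 - u) * a $ k + u * b $ k"
      using x that u(3) nth_eq_0_outside_support[of x S k] by (auto simp: support_face_def)
    moreover have "0 \<le> (1 - u) * a $ k" "0 \<le> u * b $ k"
      using a b u by (simp_all add: orthant_part_def)
    ultimately have "(1 - u) * a $ k = 0" "u * b $ k = 0" by linarith+
    then show ?thesis using u by simp
  qed
  then show "a \<in> support_face L S" "b \<in> support_face L S"
    using a b by (auto simp: support_face_def support_def)
qed

text \<open>A relative interior point \<open>x\<close> of \<open>T\<close> has the largest support:
  the segment from any \<open>y\<close> in \<open>T\<close> to \<open>x\<close> can be prolonged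
  within \<open>T\<close>, hence within the orthant. Conversely, if the support of \<open>y\<close>
  lies in that of \<open>x\<close>, a short prolongation beyond \<open>x\<close> stays in the
  polyhedron, and the face property at \<open>x\<close> puts \<open>y\<close> into
  \<open>T\<close>.\<close>

lemma support_face_if_face_of:
  assumes T: "T face_of orthant_part L" and "T \<noteq> {}"
  obtains x where "x \<in> orthant_part L" "T = support_face L (support x)"
proof -
  have TP: "T \<subseteq> orthant_part L" and cT: "convex T"
    using T by (auto simp: face_of_def)
  obtain x where xr: "x \<in> rel_interior T"
    using \<open>T \<noteq> {}\<close> rel_interior_eq_empty[OF cT] by auto
  then have xT: "x \<in> T" using rel_interior_subset by auto
  then have xP: "x \<in> orthant_part L" using TP by auto
  have "T = support_face L (support x)"
  proof (intro equalityI subsetI)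
    fix y assume y: "y \<in> T"
    obtain c where c: "c > 1" "(1 - c) *\<^sub>R y + c *\<^sub>R x \<in> T"
      using xr y convex_rel_interior_iff[OF cT \<open>T \<noteq> {}\<close>] by blast
    have "y $ k = 0" if "x $ k = 0" for k
    proof -
      \<comment> \<open>The prolonged point has the coordinate \<open>(1 - c) * y $ k\<close>, where
        \<open>1 - c\<close> is negative.\<close>
      have "0 \<le> (1 - c) * y $ k"
      proof -
        have "0 \<le> ((1 - c) *\<^sub>R y + c *\<^sub>R x) $ k" using c(2) TP by (auto simp only: orthant_part_def)
        then show ?thesis using that by simp
      qed
      moreover have "0 \<le> y $ k" using y TP by (auto simp: orthant_part_def)
      ultimately show ?thesis using c(1) by (simp add: zero_le_mult_iff)
    qed
    then show "y \<in> support_face L (support x)"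
      using y TP by (auto simp: support_face_def support_subset_iff) (simp add: support_def)
  next
    fix y assume y: "y \<in> support_face L (support x)"
    then have yP: "y \<in> orthant_part L" by (simp add: support_face_def)
    \<comment> \<open>The step length is chosen so that \<open>x + m (x - y)\<close> stays
      nonnegative. Dividing by \<open>y $ k + 1\<close> avoids a zero denominator, and the inserted
      1 covers an empty support.\<close>
    define m where "m = Min (insert 1 ((\<lambda>k. x $ k / (y $ k + 1)) ` support x))"
    have pos: "0 < x $ k / (y $ k + 1)" if "k \<in> support x" for k
    proof -
      have "0 < x $ k" using that xP by (simp add: support_def orthant_part_def order_less_le)
      moreover have "0 < y $ k + 1" using yP by (simp add: orthant_part_def add_nonneg_pos)
      ultimately show ?thesis by simp
    qed
    have m: "0 < m" "\<And>k. k \<in> support x \<Longrightarrow> m \<le> x $ k / (y $ k + 1)"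
      unfolding m_def using pos by (simp, intro Min_le) auto
    define z where "z = (1 + m) *\<^sub>R x + (- m) *\<^sub>R y"
    have "0 \<le> z $ k" for k
    proof (cases "k \<in> support x")
      case True
      have y0: "0 \<le> y $ k" and x0: "0 \<le> x $ k" using yP xP by (auto simp: orthant_part_def)
      have "m * (y $ k + 1) \<le> x $ k"
        using m(2)[OF True] y0 by (simp add: pos_le_divide_eq)
      moreover have "m * y $ k \<le> m * (y $ k + 1)" "0 \<le> m * x $ k" using m(1) x0 by simp_all
      ultimately show ?thesis by (simp add: z_def algebra_simps)
    next
      case False
      then show ?thesis using y nth_eq_0_outside_support[of y "support x" k]
        by (simp add: z_def support_face_def) (simp add: support_def)
    qed
    moreover have "z \<in> L"
      unfolding z_def using xP yP by (intro mem_affine[OF L]) (auto simp: orthant_part_def)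
    ultimately have zP: "z \<in> orthant_part L" by (simp add: orthant_part_def)
    show "y \<in> T"
    proof (cases "y = x")
      case False
      have "z - y = (1 + m) *\<^sub>R (x - y)" by (simp add: z_def algebra_simps)
      then have "y \<noteq> z" using False m(1) by auto
      have "x = (1 - 1 / (1 + m)) *\<^sub>R y + (1 / (1 + m)) *\<^sub>R z"
      proof -
        have "(1 + m) *\<^sub>R x = (1 + m) *\<^sub>R ((1 - 1 / (1 + m)) *\<^sub>R y + (1 / (1 + m)) *\<^sub>R z)"
          using m(1) by (simp add: z_def scaleR_add_right field_simps)
        then show ?thesis using m(1) by simp
      qed
      moreover have "0 < 1 / (1 + m)" "1 / (1 + m) < 1" using m(1) by simp_all
      ultimately have "x \<in> open_segment y z"
        using \<open>y \<noteq> z\<close> unfolding in_segment by blast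
      then show ?thesis using face_ofD[OF T _ yP zP xT] by blast
    qed (use xT in simp)
  qed
  then show thesis using xP that by blast
qed

text \<open>The open set \<open>?U\<close>, where all coordinates in the support of \<open>x\<close>
  are positive, contains \<open>x\<close>. Intersecting the convex set \<open>?A\<close> with it
  keeps the affine dimension and lands inside the face.\<close>

lemma aff_dim_support_face:
  assumes x: "x \<in> orthant_part L"
  shows "aff_dim (support_face L (support x)) = aff_dim {y \<in> L. support y \<subseteq> support x}"
proof (rule antisym)
  let ?U = "\<Inter>k\<in>support x. {y::real^'e. 0 < y $ k}"
  let ?A = "{y \<in> L. support y \<subseteq> support x}"
  show "aff_dim (support_face L (support x)) \<le> aff_dim ?A"
    by (rule aff_dim_subset) (auto simp: support_face_def orthant_part_def)
  have "convex ?A"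
  proof (rule convexI)
    fix y z and u v :: real
    assume "y \<in> ?A" "z \<in> ?A" "u + v = 1"
    then show "u *\<^sub>R y + v *\<^sub>R z \<in> ?A"
      using mem_affine[OF L, of y z u v] by (simp add: support_subset_iff)
  qed
  moreover have "open ?U"
    by (intro open_INT ballI open_Collect_less continuous_intros) simp
  moreover have "x \<in> ?A \<inter> ?U"
    using x by (auto simp: orthant_part_def support_def order_less_le)
  ultimately have "aff_dim ?A = aff_dim (?A \<inter> ?U)"
    by (subst aff_dim_convex_Int_open) auto
  also have "?A \<inter> ?U \<subseteq> support_face L (support x)"
  proof
    fix y assume y: "y \<in> ?A \<inter> ?U"
    have "0 \<le> y $ k" for k
      using y nth_eq_0_outside_support[of y "support x" k] by (cases "k \<in> support x") auto
    then show "y \<in> support_face L (support x)"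
      using y by (simp add: support_face_def orthant_part_def)
  qed
  then have "aff_dim (?A \<inter> ?U) \<le> aff_dim (support_face L (support x))"
    by (rule aff_dim_subset)
  finally show "aff_dim ?A \<le> aff_dim (support_face L (support x))" .
qed

end

section \<open>Supports and dimensions for flows\<close>

text \<open>The smallest tail must be 1: an inner vertex in its place would have an in-edge, whose
  tail is smaller.\<close>

lemma edge_sets_source:
  assumes "E \<in> edge_sets (n + 1) 2 {1}"
  shows "1 \<in> fst ` E"
proof -
  have fin: "finite E" using assms by (rule finite_in_edge_sets[rotated]) simp
  have ne: "E \<noteq> {}" using assms by (auto simp: edge_sets_def)
  define m where "m = Min (fst ` E)"
  have "m \<in> fst ` E" unfolding m_def using fin ne by (intro Min_in) auto
  then obtain b where b: "(m, b) \<in> E" by auto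
  have min: "m \<le> a" if "(a, c) \<in> E" for a c
    unfolding m_def using fin that by (intro Min_le) force+
  have "m = 1"
  proof (rule ccontr)
    assume "m \<noteq> 1"
    then have "2 \<le> m" "m < n + 1" using edge_setsD[OF assms b] by auto
    then obtain a where a: "(a, m) \<in> E" using assms b by (auto simp: edge_sets_def)
    then show False using min[OF a] edge_setsD(2)[OF assms a] by simp
  qed
  then show ?thesis using \<open>m \<in> fst ` E\<close> by simp
qed

lemma edge_sets_tails:
  assumes "E \<in> edge_sets (n + 1) 2 {1}"
  shows "fst ` E \<subseteq> {1..n}"
proof
  fix v assume "v \<in> fst ` E"
  then obtain b where "(v, b) \<in> E" by auto
  then show "v \<in> {1..n}" using edge_setsD[OF assms, of v b] by auto
qed

text \<open>Inner vertices are heads exactly when they are tails, the sink is always a head, and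
  vertex 1 never is.\<close>

lemma edge_sets_heads:
  assumes "E \<in> edge_sets (n + 1) 2 {1}"
  shows "snd ` E = insert (n + 1) (fst ` E - {1})"
proof (intro set_eqI)
  fix v
  have heads: "v \<in> snd ` E \<longleftrightarrow> (\<exists>a. (a, v) \<in> E)" and tails: "v \<in> fst ` E \<longleftrightarrow> (\<exists>b. (v, b) \<in> E)"
    by force+
  show "v \<in> snd ` E \<longleftrightarrow> v \<in> insert (n + 1) (fst ` E - {1})"
  proof (cases "2 \<le> v \<and> v < n + 1")
    case True
    then have "(\<exists>a. (a, v) \<in> E) \<longleftrightarrow> (\<exists>b. (v, b) \<in> E)" using assms by (simp add: edge_sets_def)
    then show ?thesis using True heads tails by auto
  next
    case False
    show ?thesis
    proof (cases "v = n + 1")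
      case True
      then show ?thesis using assms heads by (simp add: edge_sets_def)
    next
      case neq: False
      have "(a, v) \<notin> E" for a using edge_setsD(3,4)[OF assms, of a v] False neq by auto
      moreover have "v = 1 \<or> v \<notin> fst ` E" using edge_sets_tails[OF assms] False neq by auto
      ultimately show ?thesis using heads neq by auto
    qed
  qed
qed

text \<open>The heads arise from the tails by exchanging the source, always a tail, for the sink,
  never a tail.\<close>

lemma card_heads_eq_card_tails:
  assumes "E \<in> edge_sets (n + 1) 2 {1}"
  shows "card (snd ` E) = card (fst ` E)"
proof -
  have "finite (fst ` E)" using assms finite_in_edge_sets[of "{1}"] by auto
  moreover have "n + 1 \<notin> fst ` E" using edge_sets_tails[OF assms] by auto
  moreover have "card (fst ` E) > 0"
    using calculation(1) edge_sets_source[OF assms] by (auto simp: card_gt_0_iff)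
  ultimately show ?thesis
    using edge_sets_source[OF assms] by (simp add: edge_sets_heads[OF assms])
qed

section \<open>Net flows and circulations\<close>

definition net_flow :: "('e::finite \<Rightarrow> nat \<times> nat) \<Rightarrow> real ^ 'e \<Rightarrow> nat \<Rightarrow> real" where
  "net_flow e f i = (\<Sum>k | fst (e k) = i. f $ k) - (\<Sum>k | snd (e k) = i. f $ k)"

lemma net_flow_add: "net_flow e (f + g) i = net_flow e f i + net_flow e g i"
  by (simp add: net_flow_def sum.distrib)

lemma net_flow_scaleR: "net_flow e (c *\<^sub>R f) i = c * net_flow e f i"
  by (simp add: net_flow_def sum_distrib_left right_diff_distrib)

lemma net_flow_diff: "net_flow e (f - g) i = net_flow e f i - net_flow e g i"
  by (simp add: net_flow_def sum_subtractf)

lemma affine_net_flow: "affine {f. \<forall>i\<in>I. net_flow e f i = a i}"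
  unfolding affine_def
proof (intro ballI allI impI)
  fix x y and u v :: real
  assume "x \<in> {f. \<forall>i\<in>I. net_flow e f i = a i}" "y \<in> {f. \<forall>i\<in>I. net_flow e f i = a i}" "u + v = 1"
  then show "u *\<^sub>R x + v *\<^sub>R y \<in> {f. \<forall>i\<in>I. net_flow e f i = a i}"
    by (simp add: net_flow_add net_flow_scaleR distrib_right[symmetric])
qed

lemma Flow_eq_orthant_part:
  "Flow e n a = orthant_part {f. \<forall>i\<in>{1..n}. net_flow e f i = a i}"
  unfolding Flow_def orthant_part_def net_flow_def by blast

lemma edge_labelling_edge:
  assumes "edge_labelling e n"
  shows "1 \<le> fst (e k)" "fst (e k) < snd (e k)" "snd (e k) \<le> n + 1"
proof -
  have "e k \<in> K_edges (n + 1)" using assms by (auto simp: edge_labelling_def bij_betw_def)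
  then show "1 \<le> fst (e k)" "fst (e k) < snd (e k)" "snd (e k) \<le> n + 1"
    by (auto simp: K_edges_def)
qed

text \<open>Choosing an out-edge for each tail of \<open>S\<close> and replacing the value on it by the net flow of
  its tail gives a triangular, hence bijective, change of coordinates, in which the circulations
  supported in \<open>S\<close> form a coordinate subspace.\<close>

lemma dim_circulations:
  fixes e :: "'e::finite \<Rightarrow> nat \<times> nat"
  assumes e: "edge_labelling e n" and S: "e ` S \<in> edge_sets (n + 1) 2 {1}"
  shows "int (dim {f. (\<forall>i\<in>{1..n}. net_flow e f i = 0) \<and> support f \<subseteq> S}) = excess (e ` S)"
    (is "int (dim ?Z) = _")
proof -
  define V where "V = fst ` e ` S"
  have V: "V \<subseteq> {1..n}" unfolding V_def by (rule edge_sets_tails[OF S])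
  have "\<forall>v\<in>V. \<exists>k. k \<in> S \<and> fst (e k) = v" by (auto simp: V_def)
  from bchoice[OF this] obtain out where out: "\<And>v. v \<in> V \<Longrightarrow> out v \<in> S \<and> fst (e (out v)) = v"
    by blast
  have out_iff: "k \<in> out ` V \<longleftrightarrow> k = out (fst (e k)) \<and> fst (e k) \<in> V" for k
  proof
    assume "k \<in> out ` V"
    then obtain v where "v \<in> V" "k = out v" by auto
    then show "k = out (fst (e k)) \<and> fst (e k) \<in> V" using out[of v] by simp
  next
    assume "k = out (fst (e k)) \<and> fst (e k) \<in> V"
    then show "k \<in> out ` V" by (intro image_eqI[of k out "fst (e k)"]) simp_all
  qed
  define T where "T f = (\<chi> k. if k \<in> out ` V then net_flow e f (fst (e k)) else f $ k)" for f
  have T_nth: "T f $ k = (if k \<in> out ` V then net_flow e f (fst (e k)) else f $ k)" for f k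
    by (simp add: T_def)
  have lin: "linear T"
    by (rule linearI) (simp_all add: vec_eq_iff T_nth net_flow_add net_flow_scaleR)
  have "f = 0" if "T f = 0" for f
  proof -
    have 0: "f $ k = 0" if "k \<notin> out ` V" for k
      using \<open>T f = 0\<close> that T_nth[of f k] by simp
    have 1: "net_flow e f v = 0" if "v \<in> V" for v
      using \<open>T f = 0\<close> that out[OF that] T_nth[of f "out v"] by simp
    \<comment> \<open>Triangularity: edges into \<open>v\<close> have smaller tails and vanish by
      induction, and so do the unchosen out-edges of \<open>v\<close>. The net flow at
      \<open>v\<close> is then the value on the chosen edge.\<close>
    have "\<forall>k. fst (e k) = v \<longrightarrow> f $ k = 0" for v
    proof (induction v rule: less_induct)
      case (less v)
      have inflow: "(\<Sum>k | snd (e k) = v. f $ k) = 0"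
      proof (rule sum.neutral, safe)
        fix k assume "v = snd (e k)"
        then show "f $ k = 0" using less edge_labelling_edge(2)[OF e, of k] by simp
      qed
      show ?case
      proof (cases "v \<in> V")
        case True
        have "(\<Sum>k | fst (e k) = v. f $ k) = (\<Sum>k\<in>{out v}. f $ k)"
        proof (rule sum.mono_neutral_right)
          show "{out v} \<subseteq> {k. fst (e k) = v}" using out[OF True] by simp
          show "\<forall>k\<in>{k. fst (e k) = v} - {out v}. f $ k = 0" using 0 out_iff by simp
        qed simp
        then have "f $ out v = 0" using 1[OF True] inflow by (simp add: net_flow_def)
        then have "f $ k = 0" if "fst (e k) = v" for k
          using 0[of k] that by (cases "k = out v") (simp_all add: out_iff)
        then show ?thesis by simp
      next
        case False
        then have "k \<notin> out ` V" if "fst (e k) = v" for k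
          using that out_iff[of k] by simp
        then show ?thesis using 0 by simp
      qed
    qed
    then show ?thesis by (simp add: vec_eq_iff)
  qed
  then have inj: "inj T" using lin linear_injective_0 by blast
  then have surj: "surj T" using lin linear_injective_imp_surjective by blast
  have outS: "out ` V \<subseteq> S" using out by auto
  have Z_iff: "f \<in> ?Z \<longleftrightarrow> support (T f) \<subseteq> S - out ` V" for f
  proof
    assume f: "f \<in> ?Z"
    have "T f $ k = 0" if "k \<notin> S - out ` V" for k
    proof (cases "k \<in> out ` V")
      case True
      then have "fst (e k) \<in> {1..n}" using out_iff[of k] V by auto
      then show ?thesis using True f by (simp add: T_nth)
    next
      case False
      then show ?thesis using that f nth_eq_0_outside_support[of f S k] by (simp add: T_nth)
    qed
    then show "support (T f) \<subseteq> S - out ` V" by (simp add: support_subset_iff)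
  next
    assume f: "support (T f) \<subseteq> S - out ` V"
    note Tf = nth_eq_0_outside_support[OF f]
    have "f $ k = 0" if "k \<notin> S" for k
    proof -
      have "k \<notin> out ` V" using that outS by auto
      then show ?thesis using Tf[of k] that by (simp add: T_nth)
    qed
    then have supp: "support f \<subseteq> S" by (simp add: support_subset_iff)
    moreover have "net_flow e f i = 0" if i: "i \<in> {1..n}" for i
    proof (cases "i \<in> V")
      case True
      then show ?thesis using Tf[of "out i"] out[OF True] by (simp add: T_nth)
    next
      case False
      \<comment> \<open>An inner vertex or source that is not a tail is not a head either, so no
        edge of \<open>S\<close> meets it.\<close>
      have "i \<notin> snd ` e ` S"
        using False i unfolding edge_sets_heads[OF S] V_def by auto
      then have "k \<notin> S" if "fst (e k) = i \<or> snd (e k) = i" for k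
        using False that unfolding V_def by auto
      then have "f $ k = 0" if "fst (e k) = i \<or> snd (e k) = i" for k
        using that nth_eq_0_outside_support[OF supp] by blast
      then show ?thesis unfolding net_flow_def by simp
    qed
    ultimately show "f \<in> ?Z" by simp
  qed
  have "T ` ?Z = {g. \<forall>k. k \<notin> S - out ` V \<longrightarrow> g $ k = 0}"
  proof -
    have "?Z = T -` {g. support g \<subseteq> S - out ` V}" using Z_iff by auto
    then have "T ` ?Z = {g. support g \<subseteq> S - out ` V}"
      using surj by (simp only: surj_image_vimage_eq)
    then show ?thesis by (simp only: support_subset_iff)
  qed
  then have "dim (T ` ?Z) = card (S - out ` V)"
    by (simp only: dim_substandard_cart flip: dim_vec_eq)
  moreover have "dim (T ` ?Z) = dim ?Z"
    using inj by (intro dim_image_eq[OF lin]) (auto intro: inj_on_subset)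
  moreover have "card (out ` V) = card V"
    by (rule card_image, rule inj_on_inverseI[of V "\<lambda>k. fst (e k)"]) (simp add: out)
  moreover have "card (S - out ` V) + card (out ` V) = card S"
    using outS by (simp add: card_Diff_subset card_mono)
  moreover have "card (e ` S) = card S"
    using e by (intro card_image) (auto simp: edge_labelling_def bij_betw_def intro: inj_on_subset)
  \<comment> \<open>The dimension is \<open>card S - card V\<close>, with \<open>card V\<close> the
    number of tails, whereas \<open>excess\<close> subtracts the heads.\<close>
  ultimately show ?thesis
    using card_heads_eq_card_tails[OF S] by (simp add: excess_def V_def)
qed

section \<open>Flows and their supports\<close>

text \<open>The flow leaving a vertex is split evenly among its out-edges, so that it is positive on
  all of \<open>E\<close>.\<close>

function throughput :: "(nat \<times> nat) set \<Rightarrow> nat \<Rightarrow> real" where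
  "throughput E v = (if v = 1 then 1 else
     \<Sum>u | u < v \<and> (u, v) \<in> E. throughput E u / real (card {b. (u, b) \<in> E}))"
  by auto
text \<open>The restriction \<open>u < v\<close> in the sum ensures termination for arbitrary
  \<open>E\<close>; all edges of the edge sets in question satisfy it.\<close>

termination by (relation "inv_image less_than snd") auto

declare throughput.simps [simp del]

text \<open>A tail other than 1 has an in-edge, and every in-edge carries a positive share by
  induction.\<close>

lemma throughput_pos:
  assumes E: "E \<in> edge_sets (n + 1) 2 {1}" and "v \<in> fst ` E"
  shows "throughput E v > 0"
  using assms(2)
proof (induction v rule: less_induct)
  case (less v)
  have fin: "finite E" using E by (rule finite_in_edge_sets[rotated]) simp
  show ?case
  proof (cases "v = 1")
    case True
    then show ?thesis by (simp add: throughput.simps)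
  next
    case False
    obtain b where b: "(v, b) \<in> E" using less.prems by auto
    then have "2 \<le> v" "v < n + 1" using edge_setsD[OF E b] False by auto
    then obtain a where a: "(a, v) \<in> E" using E b by (auto simp: edge_sets_def)
    have "throughput E u / real (card {b. (u, b) \<in> E}) > 0" if "u < v" "(u, v) \<in> E" for u
    proof -
      have "u \<in> fst ` E" using that by force
      moreover have "finite {b. (u, b) \<in> E}"
        by (rule finite_subset[OF _ finite_imageI[OF fin, of snd]]) force
      then have "card {b. (u, b) \<in> E} > 0" using that by (auto simp: card_gt_0_iff)
      ultimately show ?thesis using less.IH that by simp
    qed
    moreover have "a < v" using edge_setsD[OF E a] by simp
    ultimately show ?thesis
      using a False by (subst throughput.simps) (auto intro!: sum_pos)
  qed
qed

text \<open>Turns out-degrees counted over labels into out-degrees counted over edges: a label with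
  tail \<open>u\<close> is determined by its head.\<close>

lemma card_out_labels:
  assumes "edge_labelling e n" "E \<subseteq> K_edges (n + 1)"
  shows "card {k. fst (e k) = u \<and> e k \<in> E} = card {b. (u, b) \<in> E}"
proof (rule bij_betw_same_card)
  show "bij_betw (\<lambda>k. snd (e k)) {k. fst (e k) = u \<and> e k \<in> E} {b. (u, b) \<in> E}"
    unfolding bij_betw_def
  proof
    have inj: "inj e" and sur: "range e = K_edges (n + 1)"
      using assms(1) by (auto simp: edge_labelling_def bij_betw_def)
    show "inj_on (\<lambda>k. snd (e k)) {k. fst (e k) = u \<and> e k \<in> E}"
      using inj by (auto simp: inj_on_def inj_def prod_eq_iff)
    show "(\<lambda>k. snd (e k)) ` {k. fst (e k) = u \<and> e k \<in> E} = {b. (u, b) \<in> E}"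
    proof (intro set_eqI iffI)
      fix b assume "b \<in> {b. (u, b) \<in> E}"
      then obtain k where "e k = (u, b)" using sur assms(2) by (metis imageE mem_Collect_eq subsetD)
      then show "b \<in> (\<lambda>k. snd (e k)) ` {k. fst (e k) = u \<and> e k \<in> E}"
        using \<open>b \<in> {b. (u, b) \<in> E}\<close> by (intro image_eqI[of _ _ k]) auto
    next
      fix b assume "b \<in> (\<lambda>k. snd (e k)) ` {k. fst (e k) = u \<and> e k \<in> E}"
      then obtain k where "(u, b) = e k" "e k \<in> E" by auto
      then show "b \<in> {b. (u, b) \<in> E}" by simp
    qed
  qed
qed

lemma edge_sets_subset_K_edges:
  assumes "E \<in> edge_sets (n + 1) 2 {1}"
  shows "E \<subseteq> K_edges (n + 1)"
proof
  fix p assume "p \<in> E"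
  then show "p \<in> K_edges (n + 1)"
    using edge_setsD[OF assms, of "fst p" "snd p"] by (cases p) (auto simp: K_edges_def)
qed

text \<open>Each out-edge of \<open>u\<close> in \<open>E\<close> gets the share \<open>w u\<close>
  of the throughput of \<open>u\<close>. The outflow of a tail is then its throughput, and
  conservation at an inner tail is the defining equation of \<open>throughput\<close>.\<close>

lemma CRY_support_exists:
  fixes e :: "'e::finite \<Rightarrow> nat \<times> nat"
  assumes e: "edge_labelling e n" and S: "e ` S \<in> edge_sets (n + 1) 2 {1}"
  obtains f where "f \<in> CRY e n" "support f = S"
proof -
  define E where "E = e ` S"
  have E: "E \<in> edge_sets (n + 1) 2 {1}" using S by (simp add: E_def)
  have EK: "E \<subseteq> K_edges (n + 1)" by (rule edge_sets_subset_K_edges[OF E])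
  have inj: "inj e" and sur: "range e = K_edges (n + 1)"
    using e by (auto simp: edge_labelling_def bij_betw_def)
  have ekE: "e k \<in> E \<longleftrightarrow> k \<in> S" for k using inj by (auto simp: E_def inj_image_mem_iff)
  define w where "w u = throughput E u / real (card {b. (u, b) \<in> E})" for u
  define f :: "real ^ 'e" where "f = (\<chi> k. if e k \<in> E then w (fst (e k)) else 0)"
  have outdeg: "card {b. (u, b) \<in> E} > 0" if "u \<in> fst ` E" for u
  proof -
    have "finite E" using E by (rule finite_in_edge_sets[rotated]) simp
    then have "finite {b. (u, b) \<in> E}"
      by (rule finite_subset[OF _ finite_imageI[of _ snd], rotated]) force
    then show ?thesis using that by (auto simp: card_gt_0_iff)
  qed
  have wpos: "w u > 0" if "u \<in> fst ` E" for u
    using throughput_pos[OF E that] outdeg[OF that] by (simp add: w_def)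
  have f_nth: "f $ k = (if e k \<in> E then w (fst (e k)) else 0)" for k by (simp add: f_def)
  have fpos: "f $ k > 0" if "e k \<in> E" for k
    using wpos[of "fst (e k)"] that by (simp add: f_nth)
  have outflow: "(\<Sum>k | fst (e k) = i. f $ k) = (if i \<in> fst ` E then throughput E i else 0)" for i
  proof -
    have "(\<Sum>k | fst (e k) = i. f $ k) = (\<Sum>k | fst (e k) = i \<and> e k \<in> E. w i)"
      by (intro sum.mono_neutral_cong_right) (auto simp: f_nth)
    also have "\<dots> = real (card {b. (i, b) \<in> E}) * w i"
      using card_out_labels[OF e EK, of i] by simp
    also have "\<dots> = (if i \<in> fst ` E then throughput E i else 0)"
    proof (cases "i \<in> fst ` E")
      case True
      then show ?thesis using outdeg[OF True] by (simp add: w_def)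
    next
      case False
      then have "{b. (i, b) \<in> E} = {}" by force
      then show ?thesis using False by simp
    qed
    finally show ?thesis .
  qed
  have inflow: "(\<Sum>k | snd (e k) = i. f $ k) = (\<Sum>u | u < i \<and> (u, i) \<in> E. w u)" for i
  proof -
    have "(\<Sum>k | snd (e k) = i. f $ k) = (\<Sum>k | snd (e k) = i \<and> e k \<in> E. w (fst (e k)))"
      by (intro sum.mono_neutral_cong_right) (auto simp: f_nth)
    also have "\<dots> = (\<Sum>u | u < i \<and> (u, i) \<in> E. w u)"
    proof (rule sum.reindex_bij_betw)
      show "bij_betw (\<lambda>k. fst (e k)) {k. snd (e k) = i \<and> e k \<in> E} {u. u < i \<and> (u, i) \<in> E}"
        unfolding bij_betw_def
      proof
        show "inj_on (\<lambda>k. fst (e k)) {k. snd (e k) = i \<and> e k \<in> E}"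
          using inj by (auto simp: inj_on_def inj_def prod_eq_iff)
        show "(\<lambda>k. fst (e k)) ` {k. snd (e k) = i \<and> e k \<in> E} = {u. u < i \<and> (u, i) \<in> E}"
        proof (intro set_eqI iffI)
          fix u assume u: "u \<in> {u. u < i \<and> (u, i) \<in> E}"
          then obtain k where "e k = (u, i)" using sur EK by (metis (no_types, lifting) imageE mem_Collect_eq subsetD)
          then show "u \<in> (\<lambda>k. fst (e k)) ` {k. snd (e k) = i \<and> e k \<in> E}"
            using u by (intro image_eqI[of _ _ k]) auto
        next
          fix u assume "u \<in> (\<lambda>k. fst (e k)) ` {k. snd (e k) = i \<and> e k \<in> E}"
          then obtain k where "(u, i) = e k" "e k \<in> E" by auto
          then have "(u, i) \<in> E" by simp
          then show "u \<in> {u. u < i \<and> (u, i) \<in> E}" using edge_setsD[OF E] by simp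
        qed
      qed
    qed
    finally show ?thesis .
  qed
  have "net_flow e f i = (if i = 1 then 1 else 0)" if i: "i \<in> {1..n}" for i
  proof (cases "i = 1")
    case True
    have "(u, i) \<notin> E" for u using edge_setsD(3)[OF E, of u i] True by auto
    then have "(\<Sum>u | u < i \<and> (u, i) \<in> E. w u) = 0" by simp
    then show ?thesis
      unfolding net_flow_def outflow inflow
      using True edge_sets_source[OF E] by (simp add: throughput.simps)
  next
    case False
    \<comment> \<open>An inner vertex that is not a tail is not a head either, so its inflow and
      outflow both vanish.\<close>
    then have "i \<in> fst ` E \<longleftrightarrow> i \<in> snd ` E" using i by (auto simp: edge_sets_heads[OF E])
    then have "(u, i) \<notin> E" if "i \<notin> fst ` E" for u using that by force
    then have "(\<Sum>u | u < i \<and> (u, i) \<in> E. w u) = 0" if "i \<notin> fst ` E"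
      using that by simp
    moreover have "throughput E i = (\<Sum>u | u < i \<and> (u, i) \<in> E. w u)"
      using False by (subst throughput.simps) (simp add: w_def)
    ultimately show ?thesis
      using False by (simp add: net_flow_def outflow inflow)
  qed
  moreover have "0 \<le> f $ k" for k using fpos[of k] by (cases "e k \<in> E") (auto simp: f_nth)
  ultimately have "f \<in> CRY e n"
    by (simp add: CRY_def Flow_eq_orthant_part orthant_part_def)
  moreover have "support f = S"
    using fpos ekE by (force simp: support_def f_nth)
  ultimately show thesis by (rule that)
qed

text \<open>By nonnegativity, a vertex has zero outflow or inflow only if no support edge leaves or
  enters it; conservation thus yields the balance condition. The largest head is the sink, since an
  inner head would have an out-edge to a larger one.\<close>

lemma CRY_support:
  fixes e :: "'e::finite \<Rightarrow> nat \<times> nat"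
  assumes e: "edge_labelling e n" and n: "n \<ge> 1" and f: "f \<in> CRY e n"
  shows "e ` support f \<in> edge_sets (n + 1) 2 {1}"
proof -
  let ?E = "e ` support f"
  have nonneg: "0 \<le> f $ k" for k
    using f by (simp add: CRY_def Flow_def)
  have net: "net_flow e f i = (if i = 1 then 1 else 0)" if "i \<in> {1..n}" for i
    using f that by (simp add: CRY_def Flow_def net_flow_def)
  have out: "(\<Sum>k | fst (e k) = i. f $ k) = 0 \<longleftrightarrow> (\<forall>b. (i, b) \<notin> ?E)" for i
    using nonneg by (subst sum_nonneg_eq_0_iff) (auto simp: support_def image_iff, metis fst_conv, metis prod.collapse)
  have "in": "(\<Sum>k | snd (e k) = i. f $ k) = 0 \<longleftrightarrow> (\<forall>a. (a, i) \<notin> ?E)" for i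
    using nonneg by (subst sum_nonneg_eq_0_iff) (auto simp: support_def image_iff, metis snd_conv, metis prod.collapse)
  have edge: "1 \<le> a" "a < b" "b \<le> n + 1" if "(a, b) \<in> ?E" for a b
    using that edge_labelling_edge[OF e] by (metis fst_conv snd_conv imageE)+
  have bal: "(\<exists>a. (a, v) \<in> ?E) \<longleftrightarrow> (\<exists>b. (v, b) \<in> ?E)" if "2 \<le> v" "v < n + 1" for v
  proof -
    have "net_flow e f v = 0" using net[of v] that by simp
    then show ?thesis using out[of v] "in"[of v] by (auto simp: net_flow_def)
  qed
  have "\<exists>a. (a, n + 1) \<in> ?E"
  proof -
    \<comment> \<open>The net flow at the source is 1 and its inflow is nonnegative, so some edge
      leaves it.\<close>
    have "(\<Sum>k | fst (e k) = 1. f $ k) \<noteq> 0"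
      using net[of 1] n sum_nonneg[of "{k. snd (e k) = 1}" "\<lambda>k. f $ k"] nonneg by (simp add: net_flow_def)
    then have ne: "snd ` ?E \<noteq> {}" using out[of 1] by auto
    define m where "m = Max (snd ` ?E)"
    have "m \<in> snd ` ?E" unfolding m_def using ne by (intro Max_in) auto
    then obtain p where "p \<in> ?E" "m = snd p" by (rule imageE)
    then obtain a where a: "(a, m) \<in> ?E" by (cases p) simp
    have max: "b \<le> m" if "(c, b) \<in> ?E" for b c
      unfolding m_def using image_eqI[OF _ that, of b snd] by (intro Max_ge) simp_all
    have "m = n + 1"
    proof (rule ccontr)
      assume "m \<noteq> n + 1"
      then have "2 \<le> m" "m < n + 1" using edge[OF a] by auto
      then obtain b where b: "(m, b) \<in> ?E" using bal a by blast
      then show False using max[OF b] edge[OF b] by simp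
    qed
    then show ?thesis using a by auto
  qed
  moreover have "(a \<in> {1} \<or> 2 \<le> a) \<and> a < b \<and> 2 \<le> b \<and> b \<le> n + 1" if "(a, b) \<in> ?E" for a b
    using edge[OF that] by auto
  ultimately show ?thesis
    unfolding edge_sets_def using bal by blast
qed

section \<open>Enumeration of the faces\<close>

text \<open>Nonempty faces correspond to the supports of flows and these to edge sets, with the
  dimension given by \<open>excess\<close>; \<open>of_bool\<close> counts the empty face.\<close>

lemma num_faces_CRY:
  fixes e :: "'e::finite \<Rightarrow> nat \<times> nat"
  assumes e: "edge_labelling e n" and n: "n \<ge> 1"
  shows "num_faces (CRY e n) d =
    of_bool (d = -1) + card {E \<in> edge_sets (n + 1) 2 {1}. excess E = d}"
proof -
  define L where "L = {f. \<forall>i\<in>{1..n}. net_flow e f i = (if i = 1 then 1 else 0)}"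
  have L: "affine L" unfolding L_def by (rule affine_net_flow)
  have P: "CRY e n = orthant_part L" by (simp add: CRY_def Flow_eq_orthant_part L_def)
  define \<S> where "\<S> = {S. e ` S \<in> edge_sets (n + 1) 2 {1}}"
  have ex: "\<exists>x. x \<in> orthant_part L \<and> support x = S" if "S \<in> \<S>" for S
    using CRY_support_exists[OF e] that unfolding P \<S>_def by blast
  have dim: "aff_dim (support_face L S) = excess (e ` S)" if mem: "S \<in> \<S>" for S
  proof -
    obtain x where x: "x \<in> orthant_part L" "support x = S" using ex[OF mem] by auto
    let ?A = "{y \<in> L. support y \<subseteq> S}"
    have xL: "x \<in> L" using x by (simp add: orthant_part_def)
    \<comment> \<open>Translating by a flow with support \<open>S\<close> turns the flow equations
      into those of circulations.\<close>
    have "(\<lambda>y. y - x) ` ?A = {f. (\<forall>i\<in>{1..n}. net_flow e f i = 0) \<and> support f \<subseteq> S}"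
    proof (intro set_eqI iffI)
      fix f assume "f \<in> (\<lambda>y. y - x) ` ?A"
      then show "f \<in> {f. (\<forall>i\<in>{1..n}. net_flow e f i = 0) \<and> support f \<subseteq> S}"
        using xL x(2)[THEN equalityD1] by (auto simp: L_def net_flow_diff support_subset_iff)
    next
      fix f assume "f \<in> {f. (\<forall>i\<in>{1..n}. net_flow e f i = 0) \<and> support f \<subseteq> S}"
      then have "f + x \<in> ?A"
        using xL x(2)[THEN equalityD1] by (auto simp: L_def net_flow_add support_subset_iff)
      then show "f \<in> (\<lambda>y. y - x) ` ?A" by (intro image_eqI[of _ _ "f + x"]) simp_all
    qed
    moreover have "x \<in> affine hull ?A" using x xL by (intro hull_inc) simp
    ultimately have "aff_dim ?A = excess (e ` S)"
      using dim_circulations[OF e, of S] mem by (simp add: aff_dim_eq_dim_subtract \<S>_def)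
    then show ?thesis using aff_dim_support_face[OF L x(1)] x(2) by simp
  qed
  have inj_face: "inj_on (support_face L) \<S>"
  proof (rule inj_onI)
    \<comment> \<open>A flow with support exactly \<open>S\<close> lies in the face of
      \<open>S'\<close> only if \<open>S \<subseteq> S'\<close>.\<close>
    have "S \<subseteq> S'" if S: "S \<in> \<S>" and eq: "support_face L S = support_face L S'" for S S'
    proof -
      obtain x where x: "x \<in> orthant_part L" "support x = S" using ex[OF S] by auto
      then have "x \<in> support_face L S'" unfolding eq[symmetric] by (simp add: support_face_def)
      then show ?thesis using x by (simp add: support_face_def)
    qed
    then show "S = S'" if "S \<in> \<S>" "S' \<in> \<S>" "support_face L S = support_face L S'" for S S'
      using that by (metis equalityI)
  qed
  have ne: "support_face L S \<noteq> {}" if "S \<in> \<S>" for S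
    using ex[OF that] by (auto simp: support_face_def)
  have "{T. T face_of CRY e n \<and> aff_dim T = d} =
      (if d = -1 then {{}} else {}) \<union> support_face L ` {S \<in> \<S>. excess (e ` S) = d}"
  proof (intro set_eqI iffI)
    fix T assume "T \<in> {T. T face_of CRY e n \<and> aff_dim T = d}"
    then have T: "T face_of orthant_part L" "aff_dim T = d" by (simp_all add: P)
    show "T \<in> (if d = -1 then {{}} else {}) \<union> support_face L ` {S \<in> \<S>. excess (e ` S) = d}"
    proof (cases "T = {}")
      case True
      then show ?thesis using T(2) by simp
    next
      case False
      obtain x where x: "x \<in> orthant_part L" "T = support_face L (support x)"
        using support_face_if_face_of[OF L T(1) False] .
      have "support x \<in> \<S>" using CRY_support[OF e n] x(1) by (simp add: \<S>_def P)
      then show ?thesis using x T dim by auto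
    qed
  next
    fix T assume "T \<in> (if d = -1 then {{}} else {}) \<union> support_face L ` {S \<in> \<S>. excess (e ` S) = d}"
    then show "T \<in> {T. T face_of CRY e n \<and> aff_dim T = d}"
      using dim support_face_face_of[OF L] by (auto simp: P split: if_splits)
  qed
  then have "num_faces (CRY e n) d =
      card ((if d = -1 then {{}} else {}) \<union> support_face L ` {S \<in> \<S>. excess (e ` S) = d})"
    by (simp add: num_faces_def)
  also have "\<dots> = of_bool (d = -1) + card (support_face L ` {S \<in> \<S>. excess (e ` S) = d})"
    using ne by (subst card_Un_disjoint) auto
  also have "card (support_face L ` {S \<in> \<S>. excess (e ` S) = d}) = card {S \<in> \<S>. excess (e ` S) = d}"
    by (rule card_image, rule inj_on_subset[OF inj_face]) simp
  also have "\<dots> = card {E \<in> edge_sets (n + 1) 2 {1}. excess E = d}"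
  proof (rule bij_betw_same_card)
    show "bij_betw ((`) e) {S \<in> \<S>. excess (e ` S) = d} {E \<in> edge_sets (n + 1) 2 {1}. excess E = d}"
      unfolding bij_betw_def
    proof
      have inj: "inj e" and sur: "range e = K_edges (n + 1)"
        using e by (auto simp: edge_labelling_def bij_betw_def)
      show "inj_on ((`) e) {S \<in> \<S>. excess (e ` S) = d}"
        using inj by (simp add: inj_on_def inj_image_eq_iff)
      show "(`) e ` {S \<in> \<S>. excess (e ` S) = d} = {E \<in> edge_sets (n + 1) 2 {1}. excess E = d}"
      proof (intro set_eqI iffI)
        fix E assume E: "E \<in> {E \<in> edge_sets (n + 1) 2 {1}. excess E = d}"
        then have "E \<subseteq> range e" using edge_sets_subset_K_edges sur by simp
        then obtain S where "E = e ` S" by (auto simp: subset_image_iff)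
        then show "E \<in> (`) e ` {S \<in> \<S>. excess (e ` S) = d}" using E by (auto simp: \<S>_def)
      qed (auto simp: \<S>_def)
    qed
  qed
  finally show ?thesis .
qed

theorem corollary4p5:
  fixes n :: nat and d :: int and e :: "'e::finite \<Rightarrow> nat \<times> nat"
  assumes "n \<ge> 1" and "d \<ge> -1" and "edge_labelling e n"
  shows "of_nat (num_faces (CRY e n) d) = fls_nth (fps_nth face_gf n) d"
  using assms by (simp add: num_faces_CRY face_gf_nth fls_nth_weight_sum fls_inverse_X)

end
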